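(* Let $x_0\in\operatorname{dom}h$, $\lambda>0$, $\varepsilon>0$, and consider PDCP$(x_0,\lambda,\varepsilon)$ with $\tau_j=j/(j+2)$ for all $j\ge1$. Then for every $j\ge1$, $$t_j\le\frac{2t_1}{j(j+1)}+\frac{16\lambda M^2}{j+1}.$$ Moreover, there is a universal constant $C>0$ such that the number of iterations for PDCP to obtain $t_j\le\varepsilon$ is at most $$C\left(\frac{\sqrt{t_1}}{\sqrt\varepsilon}+\frac{\lambda M^2}{\varepsilon}+1\right).$$
   Context: Problem. $f,h:\mathbb R^n\to\mathbb R\cup\{+\infty\}$ are proper lower semicontinuous convex functions with $\operatorname{dom}h\subset\operatorname{dom}f$, and $\phi=f+h$. Assumptions: there is a map $f':\operatorname{dom}h\to\mathbb R^n$ with $f'(x)\in\partial f(x)$ for all $x\in\operatorname{dom}h$; $\|f'(x)\|\le M$ for all $x\in\operatorname{dom}h$, for some $M>0$; $\phi$ has a minimizer. Write $\ell_f(u;y)=f(y)+\langle f'(y),u-y\rangle$. Let $h^\lambda(u)=h(u)+\frac1{2\lambda}\|u-x_0\|^2$ and $\phi^\lambda=f+h^\lambda$. PDCP$(x_0,\lambda,\varepsilon)$ (primal-dual cutting-plane): start with $\Gamma_1=\ell_f(\cdot;x_0)$. For $j=1,2,\dots$: (i) $x_j=\operatorname{argmin}_u\{\Gamma_j(u)+h^\lambda(u)\}$, $m_j=\min_u\{\Gamma_j(u)+h^\lambda(u)\}$, and $s_j\in\partial\Gamma_j(x_j)\cap(-\partial h^\lambda(x_j))$; (ii) a point $\tilde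 x_j$ is chosen with $\tilde x_1=x_1$ and $\phi^\lambda(\tilde x_j)\le\tau_{j-1}\phi^\lambda(\tilde x_{j-1})+(1-\tau_{j-1})\phi^\lambda(x_j)$ for $j\ge2$; $t_j=\phi^\lambda(\tilde x_j)-m_j$; (iii) with $\tau_j\in[0,1]$, $\Gamma_{j+1}$ is any proper lower semicontinuous convex function with $\Gamma_{j+1}\le f$ and $\Gamma_{j+1}\ge\tau_j\bar\Gamma_j+(1-\tau_j)\ell_f(\cdot;x_j)$, for some proper lower semicontinuous convex $\bar\Gamma_j\le f$ with $\bar\Gamma_j(x_j)=\Gamma_j(x_j)$ and $x_j=\operatorname{argmin}_u\{\bar\Gamma_j(u)+h^\lambda(u)\}$. PDCP stops at the first $j$ with $t_j\le\varepsilon$; the bound on $t_j$ concerns the recursion (i)-(iii) irrespective of stopping. *)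

theory Defs
  imports "HOL-Library.Extended_Real" "Jordan_Normal_Form.Matrix"
begin

text \<open>
  The iteration constant of the theorem must not depend on the dimension, so the dimension has to be
  quantified inside the formula. Hence the space of real n-vectors is \<^term>\<open>carrier_vec n :: real vec set\<close>,
  with the scalar product of \<^theory>\<open>Jordan_Normal_Form.Matrix\<close>, rather than a type indexed by the
  dimension. An extended-valued function on it is a function of type \<^typ>\<open>real vec \<Rightarrow> ereal\<close>; every
  definition below looks at its values on \<^term>\<open>carrier_vec n\<close> only.
\<close>

definition vec_norm :: "real vec \<Rightarrow> real" where
  "vec_norm x = sqrt (x \<bullet> x)"

definition eff_domain :: "nat \<Rightarrow> (real vec \<Rightarrow> ereal) \<Rightarrow> real vec set" where
  "eff_domain n f = {x \<in> carrier_vec n. f x < \<infinity>}"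

definition proper_fun :: "nat \<Rightarrow> (real vec \<Rightarrow> ereal) \<Rightarrow> bool" where
  "proper_fun n f \<longleftrightarrow> (\<forall>x\<in>carrier_vec n. f x \<noteq> -\<infinity>) \<and> eff_domain n f \<noteq> {}"

text \<open>Used for functions that never take the value \<^term>\<open>-\<infinity> :: ereal\<close>; at the end points
  of the segment the convention \<open>0 * \<infinity> = 0\<close> of type \<^typ>\<open>ereal\<close> applies.\<close>

definition convex_fun :: "nat \<Rightarrow> (real vec \<Rightarrow> ereal) \<Rightarrow> bool" where
  "convex_fun n f \<longleftrightarrow> (\<forall>x\<in>carrier_vec n. \<forall>y\<in>carrier_vec n. \<forall>a::real. 0 \<le> a \<and> a \<le> 1 \<longrightarrow>
     f (a \<cdot>\<^sub>v x + (1 - a) \<cdot>\<^sub>v y) \<le> ereal a * f x + ereal (1 - a) * f y)"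

definition lsc_fun :: "nat \<Rightarrow> (real vec \<Rightarrow> ereal) \<Rightarrow> bool" where
  "lsc_fun n f \<longleftrightarrow> (\<forall>x\<in>carrier_vec n. \<forall>c. c < f x \<longrightarrow>
     (\<exists>\<delta>>0. \<forall>y\<in>carrier_vec n. vec_norm (y - x) < \<delta> \<longrightarrow> c < f y))"

definition proper_lsc_convex :: "nat \<Rightarrow> (real vec \<Rightarrow> ereal) \<Rightarrow> bool" where
  "proper_lsc_convex n f \<longleftrightarrow> proper_fun n f \<and> lsc_fun n f \<and> convex_fun n f"

definition subdifferential :: "nat \<Rightarrow> (real vec \<Rightarrow> ereal) \<Rightarrow> real vec \<Rightarrow> real vec set" where
  "subdifferential n f x =
     {v \<in> carrier_vec n. \<forall>u\<in>carrier_vec n. f x + ereal (v \<bullet> (u - x)) \<le> f u}"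

abbreviation is_minimizer :: "nat \<Rightarrow> (real vec \<Rightarrow> ereal) \<Rightarrow> real vec \<Rightarrow> bool" where
  "is_minimizer n f x \<equiv> is_arg_min f (\<lambda>u. u \<in> carrier_vec n) x"

definition composite_problem ::
  "nat \<Rightarrow> (real vec \<Rightarrow> ereal) \<Rightarrow> (real vec \<Rightarrow> ereal) \<Rightarrow> (real vec \<Rightarrow> real vec) \<Rightarrow> real \<Rightarrow> bool" where
  "composite_problem n f h f' M \<longleftrightarrow>
     proper_lsc_convex n f \<and> proper_lsc_convex n h \<and> eff_domain n h \<subseteq> eff_domain n f \<and>
     (\<forall>x\<in>eff_domain n h. f' x \<in> subdifferential n f x) \<and>
     M > 0 \<and> (\<forall>x\<in>eff_domain n h. vec_norm (f' x) \<le> M) \<and>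
     (\<exists>x. is_minimizer n (\<lambda>u. f u + h u) x)"

definition linearization ::
  "(real vec \<Rightarrow> ereal) \<Rightarrow> (real vec \<Rightarrow> real vec) \<Rightarrow> real vec \<Rightarrow> real vec \<Rightarrow> ereal" where
  "linearization f f' y u = f y + ereal (f' y \<bullet> (u - y))"

definition prox_term ::
  "(real vec \<Rightarrow> ereal) \<Rightarrow> real \<Rightarrow> real vec \<Rightarrow> real vec \<Rightarrow> ereal" where
  "prox_term h lam x0 u = h u + ereal ((vec_norm (u - x0))\<^sup>2 / (2 * lam))"

definition prox_objective ::
  "(real vec \<Rightarrow> ereal) \<Rightarrow> (real vec \<Rightarrow> ereal) \<Rightarrow> real \<Rightarrow> real vec \<Rightarrow> real vec \<Rightarrow> ereal" where
  "prox_objective f h lam x0 u = f u + prox_term h lam x0 u"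

text \<open>
  \<open>pdcp_run\<close> says that the sequences \<open>\<Gamma>, x, s, xt\<close> (models, minimizers, dual iterates, candidate
  points; the entries of index 0 are irrelevant) are generated by the recursion, continued without
  regard to stopping. The argmin is unique by strong convexity of \<open>prox_term h lam x0\<close>, so it is
  enough to say that the point is a minimizer.
\<close>

definition pdcp_run ::
  "nat \<Rightarrow> (real vec \<Rightarrow> ereal) \<Rightarrow> (real vec \<Rightarrow> ereal) \<Rightarrow> (real vec \<Rightarrow> real vec) \<Rightarrow>
   real vec \<Rightarrow> real \<Rightarrow> (nat \<Rightarrow> real) \<Rightarrow>
   (nat \<Rightarrow> real vec \<Rightarrow> ereal) \<Rightarrow> (nat \<Rightarrow> real vec) \<Rightarrow> (nat \<Rightarrow> real vec) \<Rightarrow> (nat \<Rightarrow> real vec) \<Rightarrow> bool" where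
  "pdcp_run n f h f' x0 lam \<tau> \<Gamma> x s xt \<longleftrightarrow>
     (\<forall>j\<ge>1. 0 \<le> \<tau> j \<and> \<tau> j \<le> 1) \<and>
     (\<forall>u\<in>carrier_vec n. \<Gamma> 1 u = linearization f f' x0 u) \<and>
     (\<forall>j\<ge>1. is_minimizer n (\<lambda>u. \<Gamma> j u + prox_term h lam x0 u) (x j)) \<and>
     (\<forall>j\<ge>1. s j \<in> subdifferential n (\<Gamma> j) (x j) \<inter>
              uminus ` subdifferential n (prox_term h lam x0) (x j)) \<and>
     xt 1 = x 1 \<and>
     (\<forall>j\<ge>2. xt j \<in> carrier_vec n \<and>
        prox_objective f h lam x0 (xt j)
          \<le> ereal (\<tau> (j - 1)) * prox_objective f h lam x0 (xt (j - 1))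
            + ereal (1 - \<tau> (j - 1)) * prox_objective f h lam x0 (x j)) \<and>
     (\<forall>j\<ge>1. proper_lsc_convex n (\<Gamma> (j + 1)) \<and>
        (\<forall>u\<in>carrier_vec n. \<Gamma> (j + 1) u \<le> f u) \<and>
        (\<exists>\<Gamma>b. proper_lsc_convex n \<Gamma>b \<and> (\<forall>u\<in>carrier_vec n. \<Gamma>b u \<le> f u) \<and>
           \<Gamma>b (x j) = \<Gamma> j (x j) \<and>
           is_minimizer n (\<lambda>u. \<Gamma>b u + prox_term h lam x0 u) (x j) \<and>
           (\<forall>u\<in>carrier_vec n.
              ereal (\<tau> j) * \<Gamma>b u + ereal (1 - \<tau> j) * linearization f f' (x j) u \<le> \<Gamma> (j + 1) u)))"

definition pdcp_min ::
  "nat \<Rightarrow> (real vec \<Rightarrow> ereal) \<Rightarrow> real vec \<Rightarrow> real \<Rightarrow> (nat \<Rightarrow> real vec \<Rightarrow> ereal) \<Rightarrow> nat \<Rightarrow> ereal" where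
  "pdcp_min n h x0 lam \<Gamma> j = (INF u\<in>carrier_vec n. \<Gamma> j u + prox_term h lam x0 u)"

definition pdcp_gap ::
  "nat \<Rightarrow> (real vec \<Rightarrow> ereal) \<Rightarrow> (real vec \<Rightarrow> ereal) \<Rightarrow> real vec \<Rightarrow> real \<Rightarrow>
   (nat \<Rightarrow> real vec \<Rightarrow> ereal) \<Rightarrow> (nat \<Rightarrow> real vec) \<Rightarrow> nat \<Rightarrow> ereal" where
  "pdcp_gap n f h x0 lam \<Gamma> xt j = prox_objective f h lam x0 (xt j) - pdcp_min n h x0 lam \<Gamma> j"

definition stops_at :: "(nat \<Rightarrow> ereal) \<Rightarrow> real \<Rightarrow> nat \<Rightarrow> bool" where
  "stops_at t \<epsilon> J \<longleftrightarrow> 1 \<le> J \<and> t J \<le> ereal \<epsilon> \<and> (\<forall>i. 1 \<le> i \<and> i < J \<longrightarrow> ereal \<epsilon> < t i)"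

end

theory Submission
  imports Defs
begin

text \<open>
  Write \<open>\<phi>\<close> for \<^term>\<open>prox_objective f h lam x0\<close>, \<open>m\<^sub>j\<close> for the minimal value of model plus prox term
  and \<open>t\<^sub>j = \<phi>(xt\<^sub>j) - m\<^sub>j\<close>. The bound comes from comparing how \<open>m\<^sub>j\<close> and \<open>\<phi>(xt\<^sub>j)\<close> change in one step.

  The function \<open>\<Gamma>b + prox_term\<close> is strongly convex with modulus \<open>1/lam\<close> and has minimizer \<open>x\<^sub>j\<close> and
  minimal value \<open>m\<^sub>j\<close>, so its value at \<open>x\<^sub>j\<^sub>+\<^sub>1\<close> is at least \<open>m\<^sub>j + d\<^sup>2/(2 lam)\<close>, where
  \<open>d = \<parallel>x\<^sub>j\<^sub>+\<^sub>1 - x\<^sub>j\<parallel>\<close> (\<open>prox_minimizer_growth\<close>). The linearization of \<open>f\<close> at \<open>x\<^sub>j\<close> falls short of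
  \<open>f(x\<^sub>j\<^sub>+\<^sub>1)\<close> by at most \<open>2 M d\<close>, because the subgradients \<open>f'\<close> have norm at most \<open>M\<close>. In the convex combination
  that bounds the new model from below, the quadratic gain, of weight \<open>\<tau>\<close>, absorbs the linear loss,
  of weight \<open>1 - \<tau>\<close>, up to a constant (\<open>model_minimum_increase\<close>):
  \<open>m\<^sub>j\<^sub>+\<^sub>1 \<ge> \<tau> m\<^sub>j + (1 - \<tau>) \<phi>(x\<^sub>j\<^sub>+\<^sub>1) - 2 lam M\<^sup>2 (1 - \<tau>)\<^sup>2/\<tau>\<close>.
  The rule for the candidate points bounds \<open>\<phi>(xt\<^sub>j\<^sub>+\<^sub>1)\<close> by the same combination of \<open>\<phi>(xt\<^sub>j)\<close> and
  \<open>\<phi>(x\<^sub>j\<^sub>+\<^sub>1)\<close>, so \<open>\<phi>(x\<^sub>j\<^sub>+\<^sub>1)\<close> cancels and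
  \<open>t\<^sub>j\<^sub>+\<^sub>1 \<le> \<tau> t\<^sub>j + 2 lam M\<^sup>2 (1 - \<tau>)\<^sup>2/\<tau>\<close>.

  With \<open>\<tau> = j/(j + 2)\<close> the product \<open>j (j + 1) t\<^sub>j\<close> grows by at most \<open>16 lam M\<^sup>2\<close> per step, which
  gives the rate (\<open>weighted_recursion_rate\<close>). The rate is at most \<open>\<epsilon>\<close> once \<open>j\<close> is at least both
  \<open>2 sqrt (t\<^sub>1/\<epsilon>)\<close> and \<open>32 lam M\<^sup>2/\<epsilon>\<close>, since each of its two terms is then at most \<open>\<epsilon>/2\<close>.
\<close>

section \<open>Squared norms\<close>

lemma scalar_prod_self_nonneg: "0 \<le> x \<bullet> (x :: real vec)"
  by (auto simp: scalar_prod_def intro: sum_nonneg)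

lemma vec_norm_sq: "(vec_norm x)\<^sup>2 = x \<bullet> x"
  by (simp add: vec_norm_def scalar_prod_self_nonneg)

lemma scalar_prod_self_diff:
  fixes x y :: "real vec"
  assumes "x \<in> carrier_vec n" "y \<in> carrier_vec n"
  shows "(x - y) \<bullet> (x - y) = x \<bullet> x - 2 * (x \<bullet> y) + y \<bullet> y"
proof -
  have "(x - y) \<bullet> (x - y) = x \<bullet> x - x \<bullet> y - (y \<bullet> x - y \<bullet> y)"
    using assms by (simp add: minus_scalar_prod_distrib[of _ n] scalar_prod_minus_distrib[of _ n])
  then show ?thesis using comm_scalar_prod[OF assms] by simp
qed

text \<open>The last term is what strong convexity of the prox term consists of.\<close>

lemma sq_dist_convex_combination:
  fixes x u z :: "real vec"
  assumes c: "x \<in> carrier_vec n" "u \<in> carrier_vec n" "z \<in> carrier_vec n"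
  shows "(vec_norm (a \<cdot>\<^sub>v u + (1 - a) \<cdot>\<^sub>v x - z))\<^sup>2 =
    a * (vec_norm (u - z))\<^sup>2 + (1 - a) * (vec_norm (x - z))\<^sup>2 - a * (1 - a) * (vec_norm (u - x))\<^sup>2"
proof -
  let ?w = "a \<cdot>\<^sub>v u + (1 - a) \<cdot>\<^sub>v x"
  have w: "?w \<in> carrier_vec n" using c by simp
  have ww: "?w \<bullet> ?w = a * a * (u \<bullet> u) + 2 * a * (1 - a) * (u \<bullet> x) + (1 - a) * (1 - a) * (x \<bullet> x)"
    using c comm_scalar_prod[OF c(1,2)]
    by (simp add: scalar_prod_add_distrib[of _ n] add_scalar_prod_distrib[of _ n] algebra_simps)
  have wz: "?w \<bullet> z = a * (u \<bullet> z) + (1 - a) * (x \<bullet> z)"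
    using c by (simp add: add_scalar_prod_distrib[of _ n])
  show ?thesis
    unfolding vec_norm_sq scalar_prod_self_diff[OF w c(3)] scalar_prod_self_diff[OF c(2,3)]
      scalar_prod_self_diff[OF c(1,3)] scalar_prod_self_diff[OF c(2,1)] ww wz
    by (simp add: algebra_simps)
qed

lemma scalar_prod_young:
  fixes g w :: "real vec"
  assumes c: "g \<in> carrier_vec n" "w \<in> carrier_vec n" and "0 < b"
  shows "g \<bullet> w \<le> b / 2 * (vec_norm w)\<^sup>2 + (vec_norm g)\<^sup>2 / (2 * b)"
proof -
  have "0 \<le> (b \<cdot>\<^sub>v w - g) \<bullet> (b \<cdot>\<^sub>v w - g)" by (rule scalar_prod_self_nonneg)
  also have "\<dots> = b * b * (w \<bullet> w) - 2 * b * (g \<bullet> w) + g \<bullet> g"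
    using c comm_scalar_prod[OF c] by (subst scalar_prod_self_diff[of _ n]) auto
  finally show ?thesis using \<open>0 < b\<close> unfolding vec_norm_sq by (simp add: field_simps)
qed

text \<open>By the parallelogram law; it takes the place of the triangle inequality.\<close>

lemma sq_norm_diff_le:
  assumes c: "x \<in> carrier_vec n" "y \<in> carrier_vec n"
    and "vec_norm x \<le> M" "vec_norm y \<le> M"
  shows "(vec_norm (x - y))\<^sup>2 \<le> 4 * M\<^sup>2"
proof -
  have "0 \<le> vec_norm x" "0 \<le> vec_norm y"
    by (simp_all add: vec_norm_def scalar_prod_self_nonneg)
  then have "x \<bullet> x \<le> M\<^sup>2" "y \<bullet> y \<le> M\<^sup>2"
    using assms(3,4) power_mono unfolding vec_norm_sq[symmetric] by blast+
  moreover have "0 \<le> (x + y) \<bullet> (x + y)" by (rule scalar_prod_self_nonneg)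
  moreover have "(x + y) \<bullet> (x + y) = x \<bullet> x + 2 * (x \<bullet> y) + y \<bullet> y"
    using c comm_scalar_prod[OF c]
    by (simp add: scalar_prod_add_distrib[of _ n] add_scalar_prod_distrib[of _ n])
  ultimately show ?thesis unfolding vec_norm_sq scalar_prod_self_diff[OF c] by linarith
qed

section \<open>One step of the method\<close>

text \<open>
  Minimality is tested on the segment from \<open>x\<close> towards \<open>u\<close>: at parameter \<open>a\<close> it yields the claim
  with the factor \<open>1 - a\<close> before the quadratic term, and \<open>a\<close> tends to 0.
\<close>

lemma prox_minimizer_growth:
  assumes conv: "convex_fun n G" "convex_fun n h" and lam: "0 < lam" and x0: "x0 \<in> carrier_vec n"
    and min: "is_minimizer n (\<lambda>u. G u + prox_term h lam x0 u) x"
    and u: "u \<in> carrier_vec n"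
    and fin: "G x = ereal gx" "h x = ereal hx" "G u = ereal gu" "h u = ereal hu"
  shows "gx + hx + (vec_norm (x - x0))\<^sup>2 / (2 * lam) + (vec_norm (u - x))\<^sup>2 / (2 * lam)
    \<le> gu + hu + (vec_norm (u - x0))\<^sup>2 / (2 * lam)"
proof -
  have x: "x \<in> carrier_vec n"
    and le: "\<And>w. w \<in> carrier_vec n \<Longrightarrow>
      G x + prox_term h lam x0 x \<le> G w + prox_term h lam x0 w"
    using min by (auto simp: is_arg_min_linorder)
  define q where "q z = z / (2 * lam)" for z :: real
  define dx where "dx = (vec_norm (x - x0))\<^sup>2"
  define du where "du = (vec_norm (u - x0))\<^sup>2"
  define d where "d = (vec_norm (u - x))\<^sup>2"
  have segment: "gx + hx + q dx \<le> gu + hu + q du - (1 - a) * q d" if a: "0 < a" "a \<le> 1" for a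
  proof -
    let ?w = "a \<cdot>\<^sub>v u + (1 - a) \<cdot>\<^sub>v x"
    have w: "?w \<in> carrier_vec n" using u x by simp
    have "G ?w \<le> ereal a * G u + ereal (1 - a) * G x" "h ?w \<le> ereal a * h u + ereal (1 - a) * h x"
      using conv u x a by (auto simp: convex_fun_def)
    then have "G ?w \<le> ereal (a * gu + (1 - a) * gx)" "h ?w \<le> ereal (a * hu + (1 - a) * hx)"
      by (simp_all add: fin)
    then have "G ?w + prox_term h lam x0 ?w \<le> ereal (a * gu + (1 - a) * gx)
        + (ereal (a * hu + (1 - a) * hx) + ereal (q ((vec_norm (?w - x0))\<^sup>2)))"
      unfolding prox_term_def q_def by (intro add_mono) auto
    from order_trans[OF le[OF w] this] have "ereal (gx + hx + q dx) \<le> ereal (a * gu + (1 - a) * gx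
        + (a * hu + (1 - a) * hx) + q ((vec_norm (?w - x0))\<^sup>2))"
      by (simp add: prox_term_def fin q_def dx_def add.assoc)
    also have "q ((vec_norm (?w - x0))\<^sup>2) = a * q du + (1 - a) * q dx - a * (1 - a) * q d"
      unfolding sq_dist_convex_combination[OF x u x0] q_def du_def dx_def d_def
      using lam by (simp add: field_simps)
    finally have "a * (gx + hx + q dx) \<le> a * (gu + hu + q du - (1 - a) * q d)"
      by (simp add: algebra_simps)
    then show ?thesis using a by simp
  qed
  have "q d \<le> gu + hu + q du - (gx + hx + q dx)"
  proof (rule field_le_epsilon)
    fix e :: real assume e: "0 < e"
    have d0: "0 \<le> q d" using lam by (simp add: q_def d_def)
    \<comment> \<open>Small enough that \<open>a * q d \<le> e\<close>; the summand 1 covers \<open>u = x\<close>.\<close>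
    define a where "a = min 1 (e / (q d + 1))"
    have a: "0 < a" "a \<le> 1" using e d0 by (auto simp: a_def)
    have "a * q d \<le> e / (q d + 1) * q d" using d0 by (intro mult_right_mono) (auto simp: a_def)
    also have "\<dots> \<le> e" using d0 e by (simp add: field_simps)
    finally have "a * q d \<le> e" .
    with segment[OF a] show "q d \<le> gu + hu + q du - (gx + hx + q dx) + e"
      by (simp add: algebra_simps)
  qed
  then show ?thesis by (simp add: q_def du_def dx_def d_def)
qed

text \<open>
  The linearization error at \<open>y\<close> is at most the inner product of the difference of the subgradients
  at \<open>y\<close> and \<open>x\<close> with \<open>y - x\<close>. Young's inequality, with the parameter for which its quadratic part
  is exactly the growth of the old model, leaves the error term of the conclusion.
\<close>

lemma model_minimum_increase:
  assumes prob: "composite_problem n f h f' M" and lam: "0 < lam" and x0: "x0 \<in> carrier_vec n"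
    and t: "0 < \<tau>" "\<tau> < 1"
    and x: "x \<in> eff_domain n h" and y: "y \<in> eff_domain n h"
    and G: "proper_lsc_convex n G" and Gx: "\<bar>G x\<bar> \<noteq> \<infinity>"
    and min: "is_minimizer n (\<lambda>u. G u + prox_term h lam x0 u) x"
    and new: "ereal \<tau> * G y + ereal (1 - \<tau>) * linearization f f' x y \<le> G' y"
    and G'y: "\<bar>G' y\<bar> \<noteq> \<infinity>"
  shows "ereal \<tau> * (G x + prox_term h lam x0 x) + ereal (1 - \<tau>) * prox_objective f h lam x0 y
    \<le> G' y + prox_term h lam x0 y + ereal (2 * lam * M\<^sup>2 * ((1 - \<tau>)\<^sup>2 / \<tau>))"
proof -
  have c: "x \<in> carrier_vec n" "y \<in> carrier_vec n" and xf: "x \<in> eff_domain n f" "y \<in> eff_domain n f"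
    using x y prob by (auto simp: eff_domain_def composite_problem_def)
  have hfin: "\<bar>h x\<bar> \<noteq> \<infinity>" "\<bar>h y\<bar> \<noteq> \<infinity>" and ffin: "\<bar>f x\<bar> \<noteq> \<infinity>" "\<bar>f y\<bar> \<noteq> \<infinity>"
    using x y xf prob
    by (auto simp: eff_domain_def composite_problem_def proper_lsc_convex_def proper_fun_def)
  obtain hx hy fx fy gx g'y where r: "h x = ereal hx" "h y = ereal hy" "f x = ereal fx" "f y = ereal fy"
    "G x = ereal gx" "G' y = ereal g'y"
    using hfin ffin Gx G'y by (auto elim!: abs_ereal.elims)
  have "G y \<noteq> -\<infinity>" using G c by (auto simp: proper_lsc_convex_def proper_fun_def)
  moreover have "G y \<noteq> \<infinity>"
    using new t by (auto simp: r linearization_def)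
  ultimately obtain gy where gy: "G y = ereal gy" by (cases "G y") auto
  define q where "q z = (vec_norm (z - x0))\<^sup>2 / (2 * lam)" for z
  define d where "d = (vec_norm (y - x))\<^sup>2"
  have sub: "f' x \<in> subdifferential n f x" "f' y \<in> subdifferential n f y"
    and bd: "vec_norm (f' x) \<le> M" "vec_norm (f' y) \<le> M"
    using prob x y by (auto simp: composite_problem_def)
  then have f'c: "f' x \<in> carrier_vec n" "f' y \<in> carrier_vec n" by (auto simp: subdifferential_def)
  define p where "p = f' x \<bullet> (y - x)"
  have growth: "gx + hx + q x + d / (2 * lam) \<le> gy + hy + q y"
    using prox_minimizer_growth[of n G h lam x0 x y gx hx gy hy] G prob lam x0 min c r gy
    by (simp add: proper_lsc_convex_def composite_problem_def q_def d_def)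
  have lin: "\<tau> * gy + (1 - \<tau>) * (fx + p) \<le> g'y"
    using new by (simp add: r gy linearization_def p_def)
  have "ereal (fy + f' y \<bullet> (x - y)) \<le> ereal fx"
    using sub(2) c by (auto simp: subdifferential_def r dest!: bspec[of _ _ x])
  moreover have "f' y \<bullet> (x - y) = - (f' y \<bullet> (y - x))"
    using f'c c by (simp add: scalar_prod_minus_distrib[of _ n])
  moreover have "(f' y - f' x) \<bullet> (y - x) = f' y \<bullet> (y - x) - p"
    using f'c c unfolding p_def by (intro minus_scalar_prod_distrib[of _ n]) auto
  ultimately have err: "fy - (fx + p) \<le> (f' y - f' x) \<bullet> (y - x)" by simp
  \<comment> \<open>The solution of \<open>(1 - \<tau>) b / 2 = \<tau> / (2 lam)\<close>, which makes the two quadratic terms cancel.\<close>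
  define b where "b = \<tau> / (lam * (1 - \<tau>))"
  have b: "0 < b" using t lam by (simp add: b_def)
  have "(f' y - f' x) \<bullet> (y - x) \<le> b / 2 * d + (vec_norm (f' y - f' x))\<^sup>2 / (2 * b)"
    unfolding d_def using f'c c b by (intro scalar_prod_young[of _ n]) auto
  also have "\<dots> \<le> b / 2 * d + (4 * M\<^sup>2) / (2 * b)"
    using sq_norm_diff_le[OF f'c(2,1) bd(2,1)] b by (intro add_left_mono divide_right_mono) auto
  finally have "(1 - \<tau>) * (fy - (fx + p)) \<le> (1 - \<tau>) * (b / 2 * d + (4 * M\<^sup>2) / (2 * b))"
    using err t by (intro mult_left_mono) auto
  also have "\<dots> = \<tau> * (d / (2 * lam)) + 2 * lam * M\<^sup>2 * ((1 - \<tau>)\<^sup>2 / \<tau>)"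
    using t lam unfolding b_def by (simp add: field_simps power2_eq_square)
  finally have err': "(1 - \<tau>) * (fy - (fx + p))
    \<le> \<tau> * (d / (2 * lam)) + 2 * lam * M\<^sup>2 * ((1 - \<tau>)\<^sup>2 / \<tau>)" .
  have "\<tau> * (gx + hx + q x + d / (2 * lam)) \<le> \<tau> * (gy + hy + q y)"
    using growth t by (intro mult_left_mono) auto
  with err' lin have "\<tau> * (gx + (hx + q x)) + (1 - \<tau>) * (fy + (hy + q y))
    \<le> g'y + (hy + q y) + 2 * lam * M\<^sup>2 * ((1 - \<tau>)\<^sup>2 / \<tau>)"
    by (simp add: algebra_simps)
  then show ?thesis by (simp add: r prox_objective_def prox_term_def q_def)
qed

section \<open>The gap sequence\<close>

lemma pdcp_model_le:
  assumes prob: "composite_problem n f h f' M" and x0: "x0 \<in> eff_domain n h"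
    and run: "pdcp_run n f h f' x0 lam \<tau> \<Gamma> x s xt" and j: "1 \<le> j" and u: "u \<in> carrier_vec n"
  shows "\<Gamma> j u \<le> f u" and "\<Gamma> j u \<noteq> -\<infinity>"
proof -
  have "\<Gamma> j u \<le> f u \<and> \<Gamma> j u \<noteq> -\<infinity>"
  proof (cases "j = 1")
    case True
    have "\<Gamma> 1 u = linearization f f' x0 u" using run u by (simp add: pdcp_run_def)
    moreover have "f' x0 \<in> subdifferential n f x0" "f x0 \<noteq> -\<infinity>"
      using prob x0
      by (auto simp: composite_problem_def proper_lsc_convex_def proper_fun_def eff_domain_def)
    ultimately show ?thesis
      using u True by (cases "f x0") (auto simp: linearization_def subdifferential_def)
  next
    case False
    then have "1 \<le> j - 1" "j - 1 + 1 = j" using j by auto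
    then show ?thesis
      using run u unfolding pdcp_run_def proper_lsc_convex_def proper_fun_def by metis
  qed
  then show "\<Gamma> j u \<le> f u" and "\<Gamma> j u \<noteq> -\<infinity>" by auto
qed

text \<open>
  Since \<^term>\<open>f x0\<close> and \<^term>\<open>h x0\<close> are finite, so is the minimal value of each model plus prox term;
  this forces every iterate into the domain of \<open>h\<close>.
\<close>

lemma pdcp_iterate:
  assumes prob: "composite_problem n f h f' M" and x0: "x0 \<in> eff_domain n h"
    and run: "pdcp_run n f h f' x0 lam \<tau> \<Gamma> x s xt" and j: "1 \<le> j"
  shows "x j \<in> eff_domain n h" and "\<bar>\<Gamma> j (x j)\<bar> \<noteq> \<infinity>"
    and "pdcp_min n h x0 lam \<Gamma> j = \<Gamma> j (x j) + prox_term h lam x0 (x j)"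
proof -
  have "is_minimizer n (\<lambda>u. \<Gamma> j u + prox_term h lam x0 u) (x j)"
    using run j by (simp add: pdcp_run_def)
  then have x: "x j \<in> carrier_vec n" and le: "\<And>w. w \<in> carrier_vec n \<Longrightarrow>
      \<Gamma> j (x j) + prox_term h lam x0 (x j) \<le> \<Gamma> j w + prox_term h lam x0 w"
    by (auto simp: is_arg_min_linorder)
  have x0c: "x0 \<in> carrier_vec n" and "h x0 < \<infinity>" "f x0 < \<infinity>"
    using x0 prob by (auto simp: eff_domain_def composite_problem_def)
  then have "\<Gamma> j x0 < \<infinity>" using pdcp_model_le[OF prob x0 run j x0c] by auto
  then have "\<Gamma> j x0 + prox_term h lam x0 x0 < \<infinity>"
    using \<open>h x0 < \<infinity>\<close> by (auto simp: prox_term_def)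
  then have lt: "\<Gamma> j (x j) + prox_term h lam x0 (x j) < \<infinity>"
    using le[OF x0c] by (rule le_less_trans[rotated])
  have "h (x j) \<noteq> -\<infinity>"
    using x prob by (auto simp: composite_problem_def proper_lsc_convex_def proper_fun_def)
  with lt pdcp_model_le(2)[OF prob x0 run j x]
  show "x j \<in> eff_domain n h" and "\<bar>\<Gamma> j (x j)\<bar> \<noteq> \<infinity>"
    using x by (auto simp: prox_term_def eff_domain_def)
  show "pdcp_min n h x0 lam \<Gamma> j = \<Gamma> j (x j) + prox_term h lam x0 (x j)"
    unfolding pdcp_min_def using x le by (intro antisym INF_lower INF_greatest) auto
qed

lemma prox_term_finite:
  assumes "composite_problem n f h f' M" and "u \<in> eff_domain n h"
  shows "\<bar>prox_term h lam x0 u\<bar> \<noteq> \<infinity>" and "\<bar>prox_objective f h lam x0 u\<bar> \<noteq> \<infinity>"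
proof -
  have "\<bar>h u\<bar> \<noteq> \<infinity>" "\<bar>f u\<bar> \<noteq> \<infinity>"
    using assms
    by (auto simp: eff_domain_def composite_problem_def proper_lsc_convex_def proper_fun_def)
  then show "\<bar>prox_term h lam x0 u\<bar> \<noteq> \<infinity>" and "\<bar>prox_objective f h lam x0 u\<bar> \<noteq> \<infinity>"
    by (auto simp: prox_term_def prox_objective_def)
qed

lemma pdcp_candidate_finite:
  assumes prob: "composite_problem n f h f' M" and x0: "x0 \<in> eff_domain n h"
    and run: "pdcp_run n f h f' x0 lam \<tau> \<Gamma> x s xt" and j: "1 \<le> j"
  shows "\<bar>prox_objective f h lam x0 (xt j)\<bar> \<noteq> \<infinity>"
  using j
proof (induction j rule: dec_induct)
  case base
  have "xt 1 = x 1" using run by (simp add: pdcp_run_def)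
  then show ?case
    using prox_term_finite(2)[OF prob pdcp_iterate(1)[OF prob x0 run, of 1]] by simp
next
  case (step j)
  have "2 \<le> Suc j" using step by simp
  then have c: "xt (Suc j) \<in> carrier_vec n"
    and "prox_objective f h lam x0 (xt (Suc j))
      \<le> ereal (\<tau> (Suc j - 1)) * prox_objective f h lam x0 (xt (Suc j - 1))
        + ereal (1 - \<tau> (Suc j - 1)) * prox_objective f h lam x0 (x (Suc j))"
    using run unfolding pdcp_run_def by blast+
  moreover have "\<bar>prox_objective f h lam x0 (x (Suc j))\<bar> \<noteq> \<infinity>"
    using prox_term_finite(2)[OF prob pdcp_iterate(1)[OF prob x0 run, of "Suc j"]] by simp
  ultimately have "prox_objective f h lam x0 (xt (Suc j)) \<noteq> \<infinity>"
    using step.IH by auto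
  moreover have "prox_objective f h lam x0 (xt (Suc j)) \<noteq> -\<infinity>"
    using prob c by (auto simp: composite_problem_def proper_lsc_convex_def proper_fun_def
        prox_objective_def prox_term_def)
  ultimately show ?case by auto
qed

lemma pdcp_gap_finite:
  assumes prob: "composite_problem n f h f' M" and x0: "x0 \<in> eff_domain n h"
    and run: "pdcp_run n f h f' x0 lam \<tau> \<Gamma> x s xt" and j: "1 \<le> j"
  shows "\<bar>pdcp_gap n f h x0 lam \<Gamma> xt j\<bar> \<noteq> \<infinity>"
  using pdcp_candidate_finite[OF assms]
    prox_term_finite(1)[OF prob pdcp_iterate(1)[OF assms], of lam x0]
    pdcp_iterate(2)[OF assms]
  unfolding pdcp_gap_def pdcp_iterate(3)[OF assms] by (auto elim!: abs_ereal.elims)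

lemma pdcp_first_gap_nonneg:
  assumes prob: "composite_problem n f h f' M" and x0: "x0 \<in> eff_domain n h"
    and run: "pdcp_run n f h f' x0 lam \<tau> \<Gamma> x s xt"
  shows "0 \<le> pdcp_gap n f h x0 lam \<Gamma> xt 1"
proof -
  note it = pdcp_iterate[OF prob x0 run, of 1, simplified]
  have "x 1 \<in> carrier_vec n" using it(1) by (simp add: eff_domain_def)
  then have "\<Gamma> 1 (x 1) + prox_term h lam x0 (x 1) \<le> prox_objective f h lam x0 (x 1)"
    unfolding prox_objective_def using pdcp_model_le(1)[OF prob x0 run] by (intro add_right_mono) auto
  moreover have "xt 1 = x 1" using run by (simp add: pdcp_run_def)
  ultimately show ?thesis
    using it(2) prox_term_finite[OF prob it(1)]
    unfolding pdcp_gap_def One_nat_def it(3) by (auto simp: ereal_diff_positive)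
qed

lemma pdcp_gap_step:
  assumes prob: "composite_problem n f h f' M" and lam: "0 < lam" and x0: "x0 \<in> eff_domain n h"
    and run: "pdcp_run n f h f' x0 lam \<tau> \<Gamma> x s xt" and j: "1 \<le> j" and t: "0 < \<tau> j" "\<tau> j < 1"
  shows "real_of_ereal (pdcp_gap n f h x0 lam \<Gamma> xt (Suc j))
    \<le> \<tau> j * real_of_ereal (pdcp_gap n f h x0 lam \<Gamma> xt j) + 2 * lam * M\<^sup>2 * ((1 - \<tau> j)\<^sup>2 / \<tau> j)"
proof -
  have j': "1 \<le> Suc j" by simp
  note it = pdcp_iterate[OF prob x0 run j] and it' = pdcp_iterate[OF prob x0 run j']
  have x0c: "x0 \<in> carrier_vec n" and yc: "x (Suc j) \<in> carrier_vec n"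
    using x0 it'(1) by (auto simp: eff_domain_def)
  obtain G where G: "proper_lsc_convex n G" "G (x j) = \<Gamma> j (x j)"
    "is_minimizer n (\<lambda>u. G u + prox_term h lam x0 u) (x j)"
    "ereal (\<tau> j) * G (x (Suc j)) + ereal (1 - \<tau> j) * linearization f f' (x j) (x (Suc j))
      \<le> \<Gamma> (Suc j) (x (Suc j))"
  proof -
    have "\<forall>j\<ge>1. \<exists>G. proper_lsc_convex n G \<and> G (x j) = \<Gamma> j (x j) \<and>
        is_minimizer n (\<lambda>u. G u + prox_term h lam x0 u) (x j) \<and>
        (\<forall>u\<in>carrier_vec n. ereal (\<tau> j) * G u + ereal (1 - \<tau> j) * linearization f f' (x j) u
          \<le> \<Gamma> (j + 1) u)"
      using run unfolding pdcp_run_def by blast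
    with j yc that show thesis by auto
  qed
  have "\<bar>G (x j)\<bar> \<noteq> \<infinity>" using it(2) G(2) by simp
  from model_minimum_increase[where G' = "\<Gamma> (Suc j)",
      OF prob lam x0c t it(1) it'(1) G(1) this G(3) G(4) it'(2)]
  have low: "ereal (\<tau> j) * (\<Gamma> j (x j) + prox_term h lam x0 (x j))
      + ereal (1 - \<tau> j) * prox_objective f h lam x0 (x (Suc j))
    \<le> \<Gamma> (Suc j) (x (Suc j)) + prox_term h lam x0 (x (Suc j))
      + ereal (2 * lam * M\<^sup>2 * ((1 - \<tau> j)\<^sup>2 / \<tau> j))"
    unfolding G(2) .
  have "2 \<le> Suc j" using j by simp
  then have "prox_objective f h lam x0 (xt (Suc j))
      \<le> ereal (\<tau> (Suc j - 1)) * prox_objective f h lam x0 (xt (Suc j - 1))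
        + ereal (1 - \<tau> (Suc j - 1)) * prox_objective f h lam x0 (x (Suc j))"
    using run unfolding pdcp_run_def by blast
  then have up: "prox_objective f h lam x0 (xt (Suc j))
      \<le> ereal (\<tau> j) * prox_objective f h lam x0 (xt j)
        + ereal (1 - \<tau> j) * prox_objective f h lam x0 (x (Suc j))"
    by simp
  obtain a b c d e g k where r:
    "\<Gamma> j (x j) = ereal a" "\<Gamma> (Suc j) (x (Suc j)) = ereal b"
    "prox_term h lam x0 (x j) = ereal c" "prox_term h lam x0 (x (Suc j)) = ereal d"
    "prox_objective f h lam x0 (xt j) = ereal e" "prox_objective f h lam x0 (xt (Suc j)) = ereal g"
    "prox_objective f h lam x0 (x (Suc j)) = ereal k"
    using it(2) it'(2) prox_term_finite[OF prob it(1), of lam x0]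
      prox_term_finite[OF prob it'(1), of lam x0]
      pdcp_candidate_finite[OF prob x0 run j] pdcp_candidate_finite[OF prob x0 run j']
    by (auto elim!: abs_ereal.elims)
  show ?thesis
    using low up unfolding pdcp_gap_def it(3) it'(3) r by (simp add: algebra_simps)
qed

section \<open>From the recursion to the rate and the iteration count\<close>

text \<open>
  The weights \<open>j (j + 1)\<close> turn the factor \<open>j/(j + 2)\<close> into 1, so that the error terms, each at most
  \<open>2 K\<close> after multiplication by the weight, add up.
\<close>

lemma weighted_recursion_rate:
  fixes T :: "nat \<Rightarrow> real"
  assumes K: "0 \<le> K" and j: "1 \<le> j"
    and rec: "\<And>j. 1 \<le> j \<Longrightarrow>
      T (Suc j) \<le> real j / (real j + 2) * T j + K / (real j * (real j + 2))"
  shows "T j \<le> 2 * T 1 / (real j * (real j + 1)) + 2 * K / (real j + 1)"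
proof -
  have "real j * (real j + 1) * T j \<le> 2 * T 1 + 2 * K * (real j - 1)"
    using j
  proof (induction j rule: dec_induct)
    case base
    show ?case by simp
  next
    case (step j)
    define r where "r = real j"
    have r: "1 \<le> r" using step by (simp add: r_def)
    have "(r + 1) * (r + 2) * T (Suc j) \<le> (r + 1) * (r + 2) * (r / (r + 2) * T j + K / (r * (r + 2)))"
      using rec[OF step(1)] r unfolding r_def by (intro mult_left_mono) auto
    also have "\<dots> = r * (r + 1) * T j + K * ((r + 1) / r)"
    proof -
      have "(r + 1) * w * (r / w * T j + K / (r * w)) = r * (r + 1) * T j + K * ((r + 1) / r)"
        if "0 < w" for w
        using r that by (simp add: field_simps)
      then show ?thesis using r by simp
    qed
    also have "\<dots> \<le> r * (r + 1) * T j + K * 2"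
      using K r by (intro add_left_mono mult_left_mono) (auto simp: field_simps)
    finally show ?case using step.IH by (simp add: r_def algebra_simps)
  qed
  also have "\<dots> \<le> 2 * T 1 + 2 * K * real j" using K by (simp add: algebra_simps)
  finally have "T j \<le> (2 * T 1 + 2 * K * real j) / (real j * (real j + 1))"
    using j by (simp add: pos_le_divide_eq mult.commute)
  also have "\<dots> = 2 * T 1 / (real j * (real j + 1)) + 2 * K / (real j + 1)"
    using j by (simp add: add_divide_distrib)
  finally show ?thesis .
qed

lemma first_index_below:
  fixes T :: "nat \<Rightarrow> real"
  assumes e: "0 < e" and B: "0 \<le> B" and T1: "0 \<le> T 1"
    and rate: "\<And>j. 1 \<le> j \<Longrightarrow> T j \<le> 2 * T 1 / (real j * (real j + 1)) + 16 * B / (real j + 1)"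
  obtains J where "1 \<le> J" "T J \<le> e" "\<And>i. 1 \<le> i \<Longrightarrow> i < J \<Longrightarrow> e < T i"
    "real J \<le> 32 * (sqrt (T 1) / sqrt e + B / e + 1)"
proof -
  define S where "S = sqrt (T 1) / sqrt e"
  have S0: "0 \<le> S" and S2: "S * S = T 1 / e"
    using T1 e by (simp_all add: S_def)
  \<comment> \<open>The two summands make the two terms of the rate at most \<open>e/2\<close> each.\<close>
  define N where "N = nat \<lceil>2 * S + 32 * (B / e)\<rceil> + 1"
  have B0: "0 \<le> B / e" using B e by simp
  have N: "2 * S + 32 * (B / e) \<le> real N" "real N \<le> 2 * S + 32 * (B / e) + 2" "1 \<le> N"
    using S0 B0 unfolding N_def by linarith+
  have "T N \<le> 2 * T 1 / (real N * (real N + 1)) + 16 * B / (real N + 1)" using rate N(3) .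
  also have "2 * T 1 / (real N * (real N + 1)) \<le> e / 2"
  proof -
    have "(2 * S) * (2 * S) \<le> real N * (real N + 1)"
      using N S0 B0 by (intro mult_mono) auto
    then have "e * (4 * (T 1 / e)) \<le> e * (real N * (real N + 1))"
      using e unfolding S2[symmetric] by (intro mult_left_mono) auto
    then have "4 * T 1 \<le> e * (real N * (real N + 1))"
      using e by simp
    moreover have "0 < real N * (real N + 1)" using N(3) by simp
    ultimately show ?thesis by (simp only: pos_divide_le_eq)
  qed
  also have "16 * B / (real N + 1) \<le> e / 2"
  proof -
    have "32 * (B / e) \<le> real N + 1" using N S0 by linarith
    then show ?thesis using e N(3) by (simp add: field_simps)
  qed
  finally have TN: "T N \<le> e" by simp
  define J where "J = (LEAST j. 1 \<le> j \<and> T j \<le> e)"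
  have "1 \<le> J \<and> T J \<le> e"
    unfolding J_def by (rule LeastI[of _ N]) (use TN N in auto)
  moreover have "e < T i" if "1 \<le> i" "i < J" for i
    using not_less_Least[of i "\<lambda>j. 1 \<le> j \<and> T j \<le> e"] that unfolding J_def by auto
  moreover have "J \<le> N" unfolding J_def by (rule Least_le) (use TN N in auto)
  then have "real J \<le> 32 * (S + B / e + 1)"
    using N S0 B0 by simp
  ultimately show ?thesis using that unfolding S_def by blast
qed

theorem proposition2p3:
  shows "\<exists>C::real. C > 0 \<and>
    (\<forall>(n::nat) f h f' (M::real) x0 (lam::real) (\<epsilon>::real) \<Gamma> x s xt t.
       composite_problem n f h f' M \<and> x0 \<in> eff_domain n h \<and> lam > 0 \<and> \<epsilon> > 0 \<and>
       pdcp_run n f h f' x0 lam (\<lambda>j. real j / (real j + 2)) \<Gamma> x s xt \<and>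
       t = pdcp_gap n f h x0 lam \<Gamma> xt \<longrightarrow>
         (\<forall>j\<ge>1. \<bar>t j\<bar> \<noteq> \<infinity> \<and>
            t j \<le> 2 * t 1 / ereal (real j * (real j + 1)) + ereal (16 * lam * M\<^sup>2 / (real j + 1))) \<and>
         (\<exists>J. stops_at t \<epsilon> J \<and>
            real J \<le> C * (sqrt (real_of_ereal (t 1)) / sqrt \<epsilon> + lam * M\<^sup>2 / \<epsilon> + 1)))"
proof (rule exI[of _ 32], intro conjI allI impI)
  show "(0::real) < 32" by simp
next
  fix n :: nat and f h f' and M :: real and x0 and lam \<epsilon> :: real and \<Gamma> x s xt t
  assume A: "composite_problem n f h f' M \<and> x0 \<in> eff_domain n h \<and> lam > 0 \<and> \<epsilon> > 0 \<and>
       pdcp_run n f h f' x0 lam (\<lambda>j. real j / (real j + 2)) \<Gamma> x s xt \<and>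
       t = pdcp_gap n f h x0 lam \<Gamma> xt"
  then have prob: "composite_problem n f h f' M" and x0: "x0 \<in> eff_domain n h" and lam: "lam > 0"
    and eps: "\<epsilon> > 0" and run: "pdcp_run n f h f' x0 lam (\<lambda>j. real j / (real j + 2)) \<Gamma> x s xt"
    and t: "t = pdcp_gap n f h x0 lam \<Gamma> xt"
    by auto
  define T where "T j = real_of_ereal (t j)" for j
  have tfin: "\<bar>t j\<bar> \<noteq> \<infinity>" if "1 \<le> j" for j
    unfolding t using pdcp_gap_finite[OF prob x0 run that] .
  then have tT: "t j = ereal (T j)" if "1 \<le> j" for j
    using that by (simp add: T_def ereal_real)
  have T1: "0 \<le> T 1"
    using pdcp_first_gap_nonneg[OF prob x0 run] unfolding T_def t by (rule real_of_ereal_pos)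
  have "T (Suc j) \<le> real j / (real j + 2) * T j + 8 * (lam * M\<^sup>2) / (real j * (real j + 2))"
    if j: "1 \<le> j" for j
  proof -
    have eq: "(1 - real j / (real j + 2))\<^sup>2 / (real j / (real j + 2)) = 4 / (real j * (real j + 2))"
    proof -
      have "1 - real j / (real j + 2) = 2 / (real j + 2)" by (simp add: field_simps)
      moreover have "(2 / w)\<^sup>2 / (real j / w) = 4 / (real j * w)" if "0 < w" for w
        using j that by (simp add: field_simps power2_eq_square)
      ultimately show ?thesis by simp
    qed
    have "0 < real j / (real j + 2)" "real j / (real j + 2) < 1" using j by simp_all
    from pdcp_gap_step[OF prob lam x0 run j this] show ?thesis
      unfolding T_def t eq by simp
  qed
  from weighted_recursion_rate[OF _ _ this] lam
  have rate: "T j \<le> 2 * T 1 / (real j * (real j + 1)) + 16 * (lam * M\<^sup>2) / (real j + 1)"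
    if "1 \<le> j" for j
    using that by simp
  show "t j \<le> 2 * t 1 / ereal (real j * (real j + 1)) + ereal (16 * lam * M\<^sup>2 / (real j + 1))"
    if "1 \<le> j" for j
  proof -
    have "ereal 2 * ereal (T 1) / ereal (real j * (real j + 1))
        = ereal (2 * T 1 / (real j * (real j + 1)))"
      using that by simp
    then show ?thesis
      using rate[OF that] tT[OF that] tT[of 1] by (simp add: mult.assoc)
  qed
  show "\<bar>t j\<bar> \<noteq> \<infinity>" if "1 \<le> j" for j using tfin[OF that] .
  have "0 \<le> lam * M\<^sup>2" using lam by simp
  from first_index_below[of \<epsilon> "lam * M\<^sup>2" T, OF eps this T1 rate] obtain J where
    "1 \<le> J" "T J \<le> \<epsilon>" "\<And>i. 1 \<le> i \<Longrightarrow> i < J \<Longrightarrow> \<epsilon> < T i"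
    "real J \<le> 32 * (sqrt (T 1) / sqrt \<epsilon> + lam * M\<^sup>2 / \<epsilon> + 1)"
    by blast
  then show "\<exists>J. stops_at t \<epsilon> J \<and>
      real J \<le> 32 * (sqrt (real_of_ereal (t 1)) / sqrt \<epsilon> + lam * M\<^sup>2 / \<epsilon> + 1)"
    by (intro exI[of _ J]) (auto simp: stops_at_def tT T_def[symmetric])
qed

end
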